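(* Define the formal power series (tail sums) $H_3:=T$, $H_2:=B+T$, $H_1:=A+B+T$, $H_0:=F+A+B+T=G$, and the map $$\Phi_x(u):=u+\frac{x}{1-u}$$ on formal power series $u=u(x)$ with zero constant term. Then $$H_2(x)=\Phi_x(H_3(x)),\qquad H_1(x)=\Phi_x(H_2(x)),\qquad H_0(x)=\Phi_x(H_1(x)).$$ Equivalently, $G(x)=\Phi_x^{\,3}(T(x))$, where $\Phi_x^{\,3}$ denotes the threefold iterate of $\Phi_x$.
   Context: Let $V_4=\{0<a<b<1\}$ be a four-element chain with Gödel implication $x\Rightarrow_G y=1$ if $x\le y$ and $x\Rightarrow_G y=y$ if $x>y$. For $n\ge1$, consider the $C_{n-1}$ full bracketings of $p_1\Rightarrow_G p_2\Rightarrow_G\cdots\Rightarrow_G p_n$ in $n$ distinct variables (equivalently, full binary trees with $n$ ordered leaves $p_1,\dots,p_n$), where $C_k$ is the $k$-th Catalan number. Let $f_n,a_n,b_n,t_n$ be the number of pairs (bracketing, valuation $\{p_1,\dots,p_n\}\to V_4$) for which the bracketed formula evaluates to $0,a,b,1$ respectively, and let $g_n=f_n+a_n+b_n+t_n=4^nC_{n-1}$. Put $F(x)=\sum_{n\ge1}f_nx^n$, $A(x)=\sum_{n\ge1}a_nx^n$, $B(x)=\sum_{n\ge1}b_nx^n$, $T(x)=\sum_{n\ge1}t_nx^n$, $G(x)=\sum_{n\ge1}g_nx^n$ (formal power series). *)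

theory Defs
  imports "HOL-Computational_Algebra.Formal_Power_Series" "HOL-Library.FuncSet"
begin

datatype V4 = V0 | Va | Vb | V1

instantiation V4 :: linorder
begin

fun rank_V4 :: "V4 \<Rightarrow> nat" where
  "rank_V4 V0 = 0"
| "rank_V4 Va = 1"
| "rank_V4 Vb = 2"
| "rank_V4 V1 = 3"

definition less_eq_V4 :: "V4 \<Rightarrow> V4 \<Rightarrow> bool" where
  "x \<le> y \<longleftrightarrow> rank_V4 x \<le> rank_V4 y"

definition less_V4 :: "V4 \<Rightarrow> V4 \<Rightarrow> bool" where
  "x < y \<longleftrightarrow> rank_V4 x < rank_V4 y"

instance
proof
  fix x y z :: V4
  show "x < y \<longleftrightarrow> x \<le> y \<and> \<not> y \<le> x"
    unfolding less_eq_V4_def less_V4_def by auto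
  show "x \<le> x"
    unfolding less_eq_V4_def by simp
  show "x \<le> y \<Longrightarrow> y \<le> z \<Longrightarrow> x \<le> z"
    unfolding less_eq_V4_def by simp
  show "x \<le> y \<Longrightarrow> y \<le> x \<Longrightarrow> x = y"
    unfolding less_eq_V4_def by (cases x; cases y) auto
  show "x \<le> y \<or> y \<le> x"
    unfolding less_eq_V4_def by auto
qed

end

lemma V4_chain: "V0 < Va" "Va < Vb" "Vb < V1"
  by (simp_all add: less_V4_def)

lemma UNIV_V4: "UNIV = {V0, Va, Vb, V1}"
  using V4.exhaust by auto

definition godel_imp :: "V4 \<Rightarrow> V4 \<Rightarrow> V4" where
  "godel_imp x y = (if x \<le> y then V1 else y)"

datatype formula = Var nat | Imp formula formula

fun leaves :: "formula \<Rightarrow> nat list" where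
  "leaves (Var i) = [i]"
| "leaves (Imp \<phi> \<psi>) = leaves \<phi> @ leaves \<psi>"

fun eval_formula :: "(nat \<Rightarrow> V4) \<Rightarrow> formula \<Rightarrow> V4" where
  "eval_formula v (Var i) = v i"
| "eval_formula v (Imp \<phi> \<psi>) = godel_imp (eval_formula v \<phi>) (eval_formula v \<psi>)"

definition bracketings :: "nat \<Rightarrow> formula set" where
  "bracketings n = {\<phi>. leaves \<phi> = [1..<Suc n]}"

text \<open>Valuations are extensional functions, so that each map from the indices
  \<open>1, \<dots>, n\<close> of the variables to \<^typ>\<open>V4\<close> is counted exactly once.\<close>

definition valuations :: "nat \<Rightarrow> (nat \<Rightarrow> V4) set" where
  "valuations n = {1..n} \<rightarrow>\<^sub>E UNIV"

definition value_count :: "V4 \<Rightarrow> nat \<Rightarrow> nat" where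
  "value_count c n =
     card {(\<phi>, v). \<phi> \<in> bracketings n \<and> v \<in> valuations n \<and> eval_formula v \<phi> = c}"

definition f_count :: "nat \<Rightarrow> nat" where "f_count = value_count V0"
definition a_count :: "nat \<Rightarrow> nat" where "a_count = value_count Va"
definition b_count :: "nat \<Rightarrow> nat" where "b_count = value_count Vb"
definition t_count :: "nat \<Rightarrow> nat" where "t_count = value_count V1"

definition g_count :: "nat \<Rightarrow> nat" where
  "g_count n = f_count n + a_count n + b_count n + t_count n"

text \<open>The coefficients are taken in the field of rationals, so that the division
  by \<open>1 - u\<close> below is the library's division of formal power series.\<close>

definition gen_series :: "(nat \<Rightarrow> nat) \<Rightarrow> rat fps" where
  "gen_series c = Abs_fps (\<lambda>n. if n \<ge> 1 then of_nat (c n) else 0)"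

definition F_series :: "rat fps" where "F_series = gen_series f_count"
definition A_series :: "rat fps" where "A_series = gen_series a_count"
definition B_series :: "rat fps" where "B_series = gen_series b_count"
definition T_series :: "rat fps" where "T_series = gen_series t_count"
definition G_series :: "rat fps" where "G_series = gen_series g_count"

definition H3 :: "rat fps" where "H3 = T_series"
definition H2 :: "rat fps" where "H2 = B_series + T_series"
definition H1 :: "rat fps" where "H1 = A_series + B_series + T_series"
definition H0 :: "rat fps" where "H0 = F_series + A_series + B_series + T_series"

text \<open>The map is only meaningful for \<open>u\<close> with zero constant term, where \<open>1 - u\<close> is a
  unit. It preserves this condition, and the series \<open>H\<^sub>3, \<dots>, H\<^sub>0\<close> satisfy it.\<close>

definition Phi :: "rat fps \<Rightarrow> rat fps" where
  "Phi u = u + fps_X / (1 - u)"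

lemma Phi_nth_0: "fps_nth u 0 = 0 \<Longrightarrow> fps_nth (Phi u) 0 = 0"
  by (simp add: Phi_def fps_divide_unit)

lemma H_nth_0:
  "fps_nth H3 0 = 0" "fps_nth H2 0 = 0" "fps_nth H1 0 = 0" "fps_nth H0 0 = 0"
  by (simp_all add: H3_def H2_def H1_def H0_def F_series_def A_series_def B_series_def
      T_series_def gen_series_def)

text \<open>All sets counted above are finite, and \<^const>\<open>g_count\<close> counts all pairs.\<close>

lemma finite_leaves_eq: "finite {\<phi>. leaves \<phi> = xs}"
proof (induction "length xs" arbitrary: xs rule: less_induct)
  case less
  have ne: "leaves \<phi> \<noteq> []" for \<phi>
    by (induction \<phi>) auto
  let ?S = "\<lambda>i. (\<lambda>(\<phi>, \<psi>). Imp \<phi> \<psi>) `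
    ({\<phi>. leaves \<phi> = take i xs} \<times> {\<psi>. leaves \<psi> = drop i xs})"
  have "{\<phi>. leaves \<phi> = xs} \<subseteq> Var ` set xs \<union> (\<Union>i\<in>{1..<length xs}. ?S i)"
  proof
    fix \<chi> assume "\<chi> \<in> {\<phi>. leaves \<phi> = xs}"
    then have \<chi>: "leaves \<chi> = xs" by simp
    show "\<chi> \<in> Var ` set xs \<union> (\<Union>i\<in>{1..<length xs}. ?S i)"
    proof (cases \<chi>)
      case (Var i)
      then show ?thesis using \<chi> by auto
    next
      case (Imp \<phi> \<psi>)
      let ?i = "length (leaves \<phi>)"
      have "?i \<in> {1..<length xs}"
        using ne[of \<phi>] ne[of \<psi>] \<chi> Imp by (auto simp: Suc_le_eq)
      moreover have "\<chi> \<in> ?S ?i"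
        using \<chi> Imp by auto
      ultimately show ?thesis by blast
    qed
  qed
  moreover have "finite (\<Union>i\<in>{1..<length xs}. ?S i)"
    by (intro finite_UN_I finite_imageI finite_cartesian_product less) auto
  ultimately show ?case
    by (meson List.finite_set finite_Un finite_imageI finite_subset)
qed

lemma finite_bracketings: "finite (bracketings n)"
  unfolding bracketings_def by (rule finite_leaves_eq)

lemma finite_valuations: "finite (valuations n)"
  unfolding valuations_def by (intro finite_PiE) (auto simp: UNIV_V4)

lemma card_valuations: "card (valuations n) = 4 ^ n"
proof -
  have "card (UNIV :: V4 set) = 4"
    by (simp add: UNIV_V4)
  then show ?thesis
    unfolding valuations_def by (simp add: card_PiE)
qed

lemma g_count_eq: "g_count n = 4 ^ n * card (bracketings n)"
proof -
  let ?P = "\<lambda>c. {(\<phi>, v). \<phi> \<in> bracketings n \<and> v \<in> valuations n \<and> eval_formula v \<phi> = c}"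
  have fin: "finite (bracketings n \<times> valuations n)"
    by (intro finite_cartesian_product finite_bracketings finite_valuations)
  have "bracketings n \<times> valuations n = (\<Union>c\<in>UNIV. ?P c)"
    by auto
  moreover have "card (\<Union>c\<in>UNIV. ?P c) = (\<Sum>c\<in>UNIV. card (?P c))"
  proof (rule card_UN_disjoint)
    show "finite (UNIV :: V4 set)" by (simp add: UNIV_V4)
    show "\<forall>c\<in>UNIV. finite (?P c)"
      by (auto intro!: finite_subset[OF _ fin])
  qed auto
  moreover have "(\<Sum>c\<in>UNIV. card (?P c)) = g_count n"
    unfolding g_count_def f_count_def a_count_def b_count_def t_count_def value_count_def UNIV_V4
    by simp
  ultimately have "card (bracketings n \<times> valuations n) = g_count n"
    by metis
  then show ?thesis
    by (simp add: card_cartesian_product card_valuations mult.commute)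
qed

end

(* Below the top element an implication takes the value c exactly when its conclusion takes the
   value c and its premise a value above c. Splitting a bracketing at its root therefore gives
   V_c = x + (sum over d > c of V_d) V_c for the generating series V_c of a value c < 1, that is,
   V_c = x / (1 - H) with H the tail sum just above c. *)

theory Submission
  imports Defs
begin

section \<open>Valued formulas over an arbitrary list of variables\<close>

text \<open>Counting over an arbitrary leaf list is needed for recursion: the conclusion of a
  bracketing of \<open>[1..<Suc n]\<close> has a suffix as its leaf list, which no longer starts at
  1.\<close>

definition valued_formulas :: "V4 \<Rightarrow> nat list \<Rightarrow> (formula \<times> (nat \<Rightarrow> V4)) set" where
  "valued_formulas c xs =
     {(\<phi>, v). leaves \<phi> = xs \<and> v \<in> set xs \<rightarrow>\<^sub>E UNIV \<and> eval_formula v \<phi> = c}"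

lemma leaves_neq_Nil: "leaves \<phi> \<noteq> []"
  by (induction \<phi>) auto

lemma eval_formula_cong:
  "(\<And>i. i \<in> set (leaves \<phi>) \<Longrightarrow> v i = w i) \<Longrightarrow> eval_formula v \<phi> = eval_formula w \<phi>"
  by (induction \<phi>) auto

lemma finite_V4_set: "finite (A :: V4 set)"
  by (rule finite_subset[OF subset_UNIV]) (simp add: UNIV_V4)

lemma finite_valued_formulas: "finite (valued_formulas c xs)"
proof (rule finite_subset)
  show "valued_formulas c xs \<subseteq> {\<phi>. leaves \<phi> = xs} \<times> (set xs \<rightarrow>\<^sub>E UNIV)"
    by (auto simp: valued_formulas_def)
  show "finite ({\<phi>. leaves \<phi> = xs} \<times> (set xs \<rightarrow>\<^sub>E (UNIV :: V4 set)))"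
    by (intro finite_cartesian_product finite_leaves_eq finite_PiE)
       (simp_all add: finite_V4_set)
qed

lemma valued_formulas_Nil: "valued_formulas c [] = {}"
  by (simp add: valued_formulas_def leaves_neq_Nil)

lemma card_valued_formulas_singleton: "card (valued_formulas c [j]) = 1"
proof -
  have leaf: "leaves \<phi> = [j] \<longleftrightarrow> \<phi> = Var j" for \<phi>
    by (cases \<phi>) (simp_all add: append_eq_Cons_conv leaves_neq_Nil)
  have val: "v \<in> {j} \<rightarrow>\<^sub>E UNIV \<and> v j = c \<longleftrightarrow> v = (\<lambda>_. undefined)(j := c)" for v
  proof
    assume v: "v \<in> {j} \<rightarrow>\<^sub>E UNIV \<and> v j = c"
    show "v = (\<lambda>_. undefined)(j := c)"
    proof
      fix x show "v x = ((\<lambda>_. undefined)(j := c)) x"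
        using v by (cases "x = j") (auto intro: PiE_arb)
    qed
  qed (simp add: PiE_def extensional_def)
  have "(\<phi>, v) \<in> valued_formulas c [j] \<longleftrightarrow> \<phi> = Var j \<and> v \<in> {j} \<rightarrow>\<^sub>E UNIV \<and> v j = c" for \<phi> v
    by (auto simp: valued_formulas_def leaf)
  then have "valued_formulas c [j] = {(Var j, (\<lambda>_. undefined)(j := c))}"
    by (simp add: set_eq_iff val)
  then show ?thesis by simp
qed

section \<open>Splitting at the root and the resulting recurrence\<close>

text \<open>The index \<open>k\<close> records the number of leaves of the premise and the values of
  premise and conclusion. Distinct variables give the two subformulas disjoint leaf sets, so their
  valuations can be chosen independently and glued.\<close>

lemma bij_betw_Imp_valued_formulas:
  assumes "distinct xs" "length xs \<noteq> 1"
  shows "bij_betw (\<lambda>(k, (\<phi>, v), (\<psi>, w)).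
      (Imp \<phi> \<psi>, \<lambda>x. if x \<in> set (leaves \<phi>) then v x else w x))
    (SIGMA k : {1..<length xs} \<times> {(d, e). godel_imp d e = c}.
      valued_formulas (fst (snd k)) (take (fst k) xs) \<times>
      valued_formulas (snd (snd k)) (drop (fst k) xs))
    (valued_formulas c xs)"
    (is "bij_betw ?f ?S _")
proof -
  have un: "set (take i xs) \<union> set (drop i xs) = set xs" for i
    by (metis append_take_drop_id set_append)
  have disj: "set (take i xs) \<inter> set (drop i xs) = {}" for i
    using assms(1) by (simp add: set_take_disj_set_drop_if_distinct)
  \<comment> \<open>The inverse cuts the formula at its root. Restricting \<open>v\<close> to each
    leaf set makes the two halves extensional again. The missing \<open>Var\<close> case cannot
    arise, as a variable has exactly one leaf.\<close>
  let ?g = "\<lambda>(\<chi>, v). case \<chi> of Imp \<phi> \<psi> \<Rightarrow>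
     ((length (leaves \<phi>), eval_formula v \<phi>, eval_formula v \<psi>),
      (\<phi>, restrict v (set (leaves \<phi>))), (\<psi>, restrict v (set (leaves \<psi>))))"
  show ?thesis
  proof (rule bij_betw_byWitness[where f' = ?g])
    have left: "?g (?f s) = s \<and> ?f s \<in> valued_formulas c xs" if "s \<in> ?S" for s
    proof -
      obtain k p \<psi> w where "s = (k, p, (\<psi>, w))"
        by (rule prod_cases4)
      moreover obtain i d e where "k = (i, d, e)"
        by (rule prod_cases3)
      moreover obtain \<phi> v where "p = (\<phi>, v)"
        by (rule prod.exhaust)
      ultimately have s: "s = ((i, d, e), (\<phi>, v), (\<psi>, w))"
        by simp
      let ?u = "\<lambda>x. if x \<in> set (leaves \<phi>) then v x else w x"
      have \<phi>: "leaves \<phi> = take i xs" "v \<in> set (take i xs) \<rightarrow>\<^sub>E UNIV" "eval_formula v \<phi> = d"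
        and \<psi>: "leaves \<psi> = drop i xs" "w \<in> set (drop i xs) \<rightarrow>\<^sub>E UNIV" "eval_formula w \<psi> = e"
        and i: "1 \<le> i" "i < length xs" and imp: "godel_imp d e = c"
        using that s by (auto simp: valued_formulas_def)
      have "eval_formula ?u \<phi> = d"
        using eval_formula_cong[of \<phi> ?u v] \<phi>(3) by simp
      moreover have "eval_formula ?u \<psi> = e"
        \<comment> \<open>No leaf of \<open>\<psi>\<close> is a leaf of \<open>\<phi>\<close>, so
          \<open>?u\<close> agrees with \<open>w\<close> on all of them.\<close>
        using \<phi>(1) \<psi>(1) disj[of i] unfolding \<psi>(3)[symmetric]
        by (intro eval_formula_cong) auto
      moreover have "restrict ?u (set (leaves \<phi>)) = v"
        using \<phi> by (auto simp: fun_eq_iff PiE_def extensional_def)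
      moreover have "restrict ?u (set (leaves \<psi>)) = w"
        using \<phi>(1) \<psi> disj[of i] by (auto simp: fun_eq_iff PiE_def extensional_def)
      moreover have "?u \<in> set xs \<rightarrow>\<^sub>E UNIV"
        using \<phi> \<psi> un[of i] by (auto simp: PiE_def extensional_def)
      ultimately show ?thesis
        using \<phi>(1) \<psi>(1) i imp s by (simp add: valued_formulas_def)
    qed
    show "\<forall>s\<in>?S. ?g (?f s) = s"
      by (intro ballI left[THEN conjunct1])
    show "?f ` ?S \<subseteq> valued_formulas c xs"
      by (intro image_subsetI left[THEN conjunct2])
    have right: "?f (?g p) = p \<and> ?g p \<in> ?S" if "p \<in> valued_formulas c xs" for p
    proof -
      obtain \<chi> v where p: "p = (\<chi>, v)"
        by (rule prod.exhaust)
      have \<chi>: "leaves \<chi> = xs" "v \<in> set xs \<rightarrow>\<^sub>E UNIV" "eval_formula v \<chi> = c"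
        using that p by (auto simp: valued_formulas_def)
      then obtain \<phi> \<psi> where Imp: "\<chi> = Imp \<phi> \<psi>"
        using assms(2) by (cases \<chi>) auto
      have xs: "xs = leaves \<phi> @ leaves \<psi>"
        using \<chi>(1) Imp by simp
      have "eval_formula (restrict v (set (leaves \<theta>))) \<theta> = eval_formula v \<theta>" for \<theta>
        by (rule eval_formula_cong) simp
      \<comment> \<open>Off both leaf sets each side is \<open>undefined\<close>, since
        \<open>v\<close> is extensional on \<open>set xs\<close>.\<close>
      moreover have "(\<lambda>x. if x \<in> set (leaves \<phi>) then restrict v (set (leaves \<phi>)) x
          else restrict v (set (leaves \<psi>)) x) = v"
        using \<chi>(2) xs by (auto simp: fun_eq_iff PiE_def extensional_def)
      ultimately show ?thesis
        using \<chi>(3) xs Imp p leaves_neq_Nil[of \<phi>] leaves_neq_Nil[of \<psi>]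
        by (simp add: valued_formulas_def Suc_le_eq)
    qed
    show "\<forall>p\<in>valued_formulas c xs. ?f (?g p) = p"
      by (intro ballI right[THEN conjunct1])
    show "?g ` valued_formulas c xs \<subseteq> ?S"
      by (intro image_subsetI right[THEN conjunct2])
  qed
qed

lemma card_valued_formulas_rec:
  assumes "distinct xs" "length xs \<noteq> 1"
  shows "card (valued_formulas c xs) =
    (\<Sum>i = 1..<length xs. \<Sum>(d, e) | godel_imp d e = c.
      card (valued_formulas d (take i xs)) * card (valued_formulas e (drop i xs)))"
proof -
  have "finite {(d, e). godel_imp d e = c}"
    by (rule finite_subset[OF subset_UNIV]) (intro finite_Prod_UNIV finite_V4_set)
  then show ?thesis
    using bij_betw_same_card[OF bij_betw_Imp_valued_formulas[OF assms, of c]]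
    by (simp add: card_SigmaI finite_valued_formulas card_cartesian_product
        sum.cartesian_product case_prod_unfold)
qed

text \<open>The names of the variables do not matter: the recurrence sees \<open>xs\<close> only
  through the counts for its shorter prefixes and suffixes, so induction on the length applies. This
  lets suffixes be counted by \<open>value_count\<close>.\<close>

lemma card_valued_formulas_cong_length:
  assumes "distinct xs" "distinct ys" "length xs = length ys"
  shows "card (valued_formulas c xs) = card (valued_formulas c ys)"
  using assms
proof (induction "length xs" arbitrary: xs ys c rule: less_induct)
  case less
  show ?case
  proof (cases "length xs = 1")
    case True
    then obtain x y where "xs = [x]" "ys = [y]"
      using less.prems(3) by (metis One_nat_def length_0_conv length_Suc_conv)
    then show ?thesis by (simp add: card_valued_formulas_singleton)
  next
    case False
    have "card (valued_formulas d (take i xs)) = card (valued_formulas d (take i ys))"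
         "card (valued_formulas d (drop i xs)) = card (valued_formulas d (drop i ys))"
      if "i \<in> {1..<length xs}" for i d
      using that less.prems by (auto intro!: less.hyps)
    then show ?thesis
      using False less.prems by (simp add: card_valued_formulas_rec)
  qed
qed

lemma value_count_eq: "value_count c n = card (valued_formulas c [1..<Suc n])"
proof -
  have "set [1..<Suc n] = {1..n}" by auto
  then show ?thesis
    by (simp only: value_count_def valued_formulas_def bracketings_def valuations_def
        mem_Collect_eq)
qed

lemma card_valued_formulas:
  assumes "distinct xs"
  shows "card (valued_formulas c xs) = value_count c (length xs)"
  unfolding value_count_eq using assms
  by (intro card_valued_formulas_cong_length) (simp_all del: upt_Suc)

lemma value_count_0: "value_count c 0 = 0"
  by (simp add: value_count_eq valued_formulas_Nil)

text \<open>The indicator of \<open>n = 1\<close> counts the lone variable; it becomes the summand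
  \<open>fps_X\<close> of the series. For \<open>n = 0\<close> both sides vanish.\<close>

lemma value_count_rec:
  assumes "c \<noteq> V1"
  shows "value_count c n = (if n = 1 then 1 else 0) +
    (\<Sum>i = 1..<n. (\<Sum>d | c < d. value_count d i) * value_count c (n - i))"
proof (cases "n = 1")
  case True
  then show ?thesis
    by (simp add: value_count_eq card_valued_formulas_singleton)
next
  case False
  \<comment> \<open>\<open>godel_imp d e\<close> is \<open>V1\<close> or \<open>e\<close>, so a
    value other than \<open>V1\<close> can only come from the branch \<open>d > e\<close>, with
    \<open>e = c\<close>.\<close>
  have pairs: "{(d, e). godel_imp d e = c} = {d. c < d} \<times> {c}"
    using assms by (auto simp: godel_imp_def split: if_splits)
  have "value_count c n =
    (\<Sum>i = 1..<n. \<Sum>(d, e) | godel_imp d e = c. value_count d i * value_count e (n - i))"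
    unfolding value_count_eq[of c n] using False
    by (subst card_valued_formulas_rec)
       (auto simp: card_valued_formulas simp del: upt_Suc intro!: sum.cong)
  also have "\<dots> = (\<Sum>i = 1..<n. (\<Sum>d | c < d. value_count d i) * value_count c (n - i))"
    by (simp add: pairs sum.cartesian_product[symmetric] sum_distrib_right)
  finally show ?thesis using False by simp
qed

section \<open>Generating series\<close>

text \<open>Forcing the constant coefficient to 0 in \<open>gen_series\<close> changes nothing here,
  because no formula has an empty leaf list.\<close>

lemma gen_series_value_count_nth:
  "fps_nth (gen_series (value_count c)) n = of_nat (value_count c n)"
  by (cases n) (simp_all add: gen_series_def value_count_0)

lemma gen_series_value_count:
  assumes "c \<noteq> V1"
  shows "gen_series (value_count c) =
    fps_X / (1 - (\<Sum>d | c < d. gen_series (value_count d)))"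
proof -
  let ?V = "\<lambda>c. gen_series (value_count c)" and ?U = "\<Sum>d | c < d. gen_series (value_count d)"
  have "fps_nth (?V c) n = fps_nth (fps_X + ?U * ?V c) n" for n
  proof -
    have "fps_nth (?U * ?V c) n =
        (\<Sum>i = 0..n. of_nat ((\<Sum>d | c < d. value_count d i) * value_count c (n - i)))"
      by (simp add: fps_mult_nth fps_sum_nth gen_series_value_count_nth)
    \<comment> \<open>The Cauchy product also contains the terms \<open>i = 0\<close> and
      \<open>i = n\<close>; both have a factor \<open>value_count _ 0 = 0\<close>.\<close>
    also have "\<dots> =
        (\<Sum>i = 1..<n. of_nat ((\<Sum>d | c < d. value_count d i) * value_count c (n - i)))"
    proof (rule sum.mono_neutral_right)
      show "\<forall>i\<in>{0..n} - {1..<n}.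
          of_nat ((\<Sum>d | c < d. value_count d i) * value_count c (n - i)) = (0 :: rat)"
      proof
        fix i assume "i \<in> {0..n} - {1..<n}"
        then have "i = 0 \<or> n - i = 0" by auto
        then show "of_nat ((\<Sum>d | c < d. value_count d i) * value_count c (n - i)) = (0 :: rat)"
          by (auto simp: value_count_0)
      qed
    qed auto
    finally show ?thesis
      unfolding gen_series_value_count_nth
      by (subst value_count_rec[OF assms]) simp
  qed
  then have "?V c = fps_X + ?U * ?V c"
    by (simp add: fps_eq_iff)
  then have "?V c * (1 - ?U) = fps_X"
    by (simp add: algebra_simps)
  \<comment> \<open>The tail sum has zero constant term, so \<open>1 - ?U\<close> is nonzero and the
    equation can be divided by it.\<close>
  moreover have "fps_nth (1 - ?U) 0 = 1"
    by (simp add: fps_sum_nth gen_series_def)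
  then have "1 - ?U \<noteq> 0"
    by (metis fps_zero_nth zero_neq_one)
  ultimately show ?thesis
    by (metis nonzero_mult_div_cancel_right)
qed

theorem proposition2:
  shows "H2 = Phi H3 \<and> H1 = Phi H2 \<and> H0 = Phi H1
    \<and> H0 = G_series \<and> G_series = (Phi ^^ 3) T_series"
proof -
  have "V0 < d \<longleftrightarrow> d \<in> {Va, Vb, V1}" "Va < d \<longleftrightarrow> d \<in> {Vb, V1}" "Vb < d \<longleftrightarrow> d \<in> {V1}" for d
    by (cases d; simp add: less_V4_def)+
  then have above: "{d. V0 < d} = {Va, Vb, V1}" "{d. Va < d} = {Vb, V1}" "{d. Vb < d} = {V1}"
    by blast+
  have "B_series = fps_X / (1 - H3)" "A_series = fps_X / (1 - H2)" "F_series = fps_X / (1 - H1)"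
    unfolding H3_def H2_def H1_def F_series_def A_series_def B_series_def T_series_def
      f_count_def a_count_def b_count_def t_count_def
    by (subst gen_series_value_count; simp add: above add.assoc)+
  \<comment> \<open>Each tail sum extends the one above it by a single series, and that series is
    exactly the fraction added by \<open>Phi\<close>.\<close>
  then have H: "H2 = Phi H3" "H1 = Phi H2" "H0 = Phi H1"
    unfolding Phi_def by (simp_all add: H0_def H1_def H2_def H3_def)
  moreover have "H0 = G_series"
    by (simp add: H0_def F_series_def A_series_def B_series_def T_series_def G_series_def
        gen_series_def g_count_def fps_eq_iff)
  moreover have "(Phi ^^ 3) T_series = H0"
    by (simp add: H eval_nat_numeral flip: H3_def)
  ultimately show ?thesis by simp
qed

end
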